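(* Let $G$ and $T$ be groups. Suppose that $H=\mathrm{im}(\varphi)=\varphi(G)\le T$ is the image of $G$ under a homomorphism $\varphi:G\to T$, and $V=\varphi(U)$ is the image of an arbitrary subgroup $U\le G$. Then the following claims hold without any further necessary assumptions. (1) The commutator subgroup of $V$ is the image of the commutator subgroup of $U$, that is, $V'=\varphi(U')$. (2) The restriction $\varphi|_U:U\to V$ is an epimorphism which induces a unique epimorphism $\tilde\varphi:U/U'\to V/V'$, $xU'\mapsto\varphi(x)V'$. Thus the abelianization of $V$, $V/V'\simeq (U/U')/\ker(\tilde\varphi)$, is an epimorphic image of the abelianization of $U$, namely the quotient of $U/U'$ by the kernel of $\tilde\varphi$, which is given by $\ker(\tilde\varphi)=\bigl(U'\cdot\ker(\varphi)\cap U\bigr)/U'$. (3) Moreover, the map $\tilde\varphi$ is an isomorphism, and the quotients $V/V'\simeq U/U'$ are isomorphic, if and only if $\ker(\varphi)\le U'$.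
   Context: For a group $X$, $X'=[X,X]$ denotes its commutator subgroup, and $X/X'$ its abelianization.
   Formalization: Claim (3) fails for arbitrary U (G=Z/2, T=U=1); proved instead: the equivalence with ker(φ|_U) ≤ U' for every U, sufficiency of ker(φ) ≤ U' for every U, and the stated equivalence when ker(φ) ≤ U. *)

theory Defs
  imports "HOL-Algebra.Generated_Groups"
begin

(* The abelianization U/U' of a subgroup U of G. The commutator subgroup U' = [U,U] is
   "derived G U"; by group.derived_consistent it does not matter whether it is formed in G
   or in the group U. Note that the elements of a Mod-quotient are right cosets, which
   agree with the left cosets xU' since U' is normal in U (group.derived_subgroup_is_normal). *)
definition abelianization :: "('a, 'm) monoid_scheme \<Rightarrow> 'a set \<Rightarrow> 'a set monoid"
  where "abelianization G U = (G\<lparr>carrier := U\<rparr>) Mod (derived G U)"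

end

theory Submission
  imports Defs
begin

text \<open>
  Everything rests on commutators being preserved by homomorphisms: \<open>\<phi>\<close> maps the commutators of
  \<open>U\<close> onto those of \<open>V\<close>, so \<open>V' = \<phi>(U')\<close>. Hence the composite \<open>U \<rightarrow> V \<rightarrow> V/V'\<close>
  kills \<open>U'\<close> and factors through \<open>U/U'\<close>; the factor is unique because
  every element of \<open>U/U'\<close> is a coset \<open>xU'\<close>, and it is onto because the composite is.

  A coset \<open>xU'\<close> lies in the kernel of the induced map iff \<open>\<phi>(x) \<in> V' = \<phi>(U')\<close>, that is, iff
  \<open>x\<close> differs from an element of \<open>U'\<close> by an element of \<open>ker \<phi>\<close>
  (\<open>preimage_of_image_eq_set_mult_kernel\<close>). So the kernel is \<open>(U' ker \<phi> \<inter> U)/U'\<close>, and the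
  first isomorphism theorem gives \<open>V/V'\<close> as the quotient by it. The induced map is an
  isomorphism iff this kernel is trivial, i.e. \<open>U' ker \<phi> \<inter> U \<subseteq> U'\<close>. Since \<open>U' \<le> U\<close>, Dedekind's
  modular law turns the left side into \<open>U' (ker \<phi> \<inter> U)\<close>, so the condition is
  \<open>ker \<phi> \<inter> U \<subseteq> U'\<close>, and \<open>ker \<phi> \<inter> U\<close> is the kernel of the restriction \<open>\<phi>|U\<close>.
\<close>

section \<open>Abelianization of a subgroup\<close>

context group
begin

lemma derived_subset_subgroup:
  assumes "subgroup U G"
  shows "derived G U \<subseteq> U"
  using derived_incl[OF _ assms] by simp

text \<open>Elements of a quotient by \<open>Mod\<close> are right cosets, while the induced map is described on
  left cosets; they agree because \<open>U'\<close> is normal in \<open>U\<close> (though perhaps not in \<open>G\<close>).\<close>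

lemma l_coset_derived_eq_r_coset:
  assumes "subgroup U G" and "x \<in> U"
  shows "x <# derived G U = derived G U #> x"
  using normal.coset_eq[OF derived_subgroup_is_normal[OF assms(1)]] assms(2)
  by (simp add: r_coset_def l_coset_def)

lemma l_coset_eq_self_iff:
  assumes "subgroup N G" and "x \<in> carrier G"
  shows "x <# N = N \<longleftrightarrow> x \<in> N"
proof
  assume "x <# N = N"
  moreover have "x \<in> x <# N"
    using assms subgroup.one_closed[OF assms(1)] by (force simp: l_coset_def)
  ultimately show "x \<in> N" by simp
next
  assume "x \<in> N"
  then show "x <# N = N"
    using coset_join3[OF assms(2,1)] by simp
qed

lemma group_abelianization:
  assumes "subgroup U G"
  shows "group (abelianization G U)"
  unfolding abelianization_def
  by (rule normal.factorgroup_is_group[OF derived_subgroup_is_normal[OF assms]])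

lemma one_abelianization: "\<one>\<^bsub>abelianization G U\<^esub> = derived G U"
  by (simp add: abelianization_def)

lemma abelianization_projection_eq:
  assumes "subgroup U G" and "x \<in> U"
  shows "x <# derived G U = derived G U #>\<^bsub>G\<lparr>carrier := U\<rparr>\<^esub> x"
  using l_coset_derived_eq_r_coset[OF assms] by (simp add: r_coset_def)

lemma carrier_abelianization:
  assumes "subgroup U G"
  shows "carrier (abelianization G U) = (\<lambda>x. x <# derived G U) ` U"
  using abelianization_projection_eq[OF assms]
  by (simp add: abelianization_def carrier_FactGroup)

lemma abelianization_projection_epi:
  assumes "subgroup U G"
  shows "(\<lambda>x. x <# derived G U) \<in> epi (G\<lparr>carrier := U\<rparr>) (abelianization G U)"
proof -
  interpret U: group "G\<lparr>carrier := U\<rparr>"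
    using subgroup_imp_group[OF assms] .
  have "(\<lambda>x. derived G U #>\<^bsub>G\<lparr>carrier := U\<rparr>\<^esub> x) \<in> hom (G\<lparr>carrier := U\<rparr>) (abelianization G U)"
    unfolding abelianization_def
    by (rule normal.r_coset_hom_Mod[OF derived_subgroup_is_normal[OF assms]])
  then have "(\<lambda>x. x <# derived G U) \<in> hom (G\<lparr>carrier := U\<rparr>) (abelianization G U)"
    by (rule U.hom_restrict) (simp add: abelianization_projection_eq[OF assms])
  then show ?thesis
    by (simp add: epi_def carrier_abelianization[OF assms])
qed

end

section \<open>The induced map of abelianizations\<close>

context group_hom
begin

lemma epi_restrict_subgroup:
  assumes "subgroup U G"
  shows "restrict h U \<in> epi (G\<lparr>carrier := U\<rparr>) (H\<lparr>carrier := h ` U\<rparr>)"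
  using subgroup.subset[OF assms] subgroup.m_closed[OF assms]
  by (auto simp: epi_def hom_def subset_iff)

lemma kernel_restrict_subgroup:
  assumes "subgroup U G"
  shows "kernel (G\<lparr>carrier := U\<rparr>) (H\<lparr>carrier := h ` U\<rparr>) (restrict h U) = kernel G H h \<inter> U"
  using subgroup.subset[OF assms] by (auto simp: kernel_def)

lemma preimage_of_image_eq_set_mult_kernel:
  assumes "N \<subseteq> carrier G" and "x \<in> carrier G"
  shows "h x \<in> h ` N \<longleftrightarrow> x \<in> N <#> kernel G H h"
proof
  assume "h x \<in> h ` N"
  then obtain n where n: "n \<in> N" "h x = h n" by auto
  then have nc: "n \<in> carrier G" using assms by auto
  then have "inv n \<otimes> x \<in> kernel G H h" "x = n \<otimes> (inv n \<otimes> x)"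
    using n assms by (simp_all add: kernel_def flip: G.m_assoc)
  then show "x \<in> N <#> kernel G H h"
    using n unfolding set_mult_def by blast
next
  assume "x \<in> N <#> kernel G H h"
  then obtain n k where "n \<in> N" "k \<in> carrier G" "h k = \<one>\<^bsub>H\<^esub>" "x = n \<otimes> k"
    by (auto simp: set_mult_def kernel_def)
  then show "h x \<in> h ` N"
    using assms by (auto simp: subset_iff)
qed

text \<open>The reason is Dedekind's modular law \<open>NK \<inter> U = N(K \<inter> U)\<close> for \<open>N \<le> U\<close>: if \<open>x = nk \<in> U\<close>, then also \<open>k = n\<^sup>-\<^sup>1x \<in> U\<close>.\<close>

lemma set_mult_kernel_Int_subset_iff:
  assumes N: "subgroup N G" and U: "subgroup U G" and "N \<subseteq> U"
  shows "(N <#> kernel G H h) \<inter> U \<subseteq> N \<longleftrightarrow> kernel G H h \<inter> U \<subseteq> N"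
proof
  assume L: "(N <#> kernel G H h) \<inter> U \<subseteq> N"
  have "kernel G H h \<subseteq> N <#> kernel G H h"
    using subgroup.one_closed[OF N] by (force simp: set_mult_def kernel_def)
  with L show "kernel G H h \<inter> U \<subseteq> N" by blast
next
  assume R: "kernel G H h \<inter> U \<subseteq> N"
  show "(N <#> kernel G H h) \<inter> U \<subseteq> N"
  proof
    fix x assume "x \<in> (N <#> kernel G H h) \<inter> U"
    then obtain n k where x: "n \<in> N" "k \<in> kernel G H h" "x = n \<otimes> k" "x \<in> U"
      by (auto simp: set_mult_def)
    then have "n \<in> carrier G" "k \<in> carrier G"
      using subgroup.subset[OF N] by (auto simp: kernel_def)
    then have k: "k = inv n \<otimes> x"
      using x by (simp flip: G.m_assoc)
    have "k \<in> U"
      unfolding k using x \<open>N \<subseteq> U\<close> subgroup.m_closed[OF U] subgroup.m_inv_closed[OF U] by blast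
    then show "x \<in> N"
      using x R subgroup.m_closed[OF N] by auto
  qed
qed

text \<open>The composite \<open>U \<rightarrow> h(U) \<rightarrow> h(U)/h(U)'\<close>, which the induced map factors.\<close>

lemma epi_onto_abelianization_of_image:
  assumes "subgroup U G"
  shows "(\<lambda>x. h x <#\<^bsub>H\<^esub> derived H (h ` U)) \<in> epi (G\<lparr>carrier := U\<rparr>) (abelianization H (h ` U))"
proof -
  interpret U: group "G\<lparr>carrier := U\<rparr>"
    using G.subgroup_imp_group[OF assms] .
  let ?q = "\<lambda>y. y <#\<^bsub>H\<^esub> derived H (h ` U)"
  have q: "?q \<circ> restrict h U \<in> epi (G\<lparr>carrier := U\<rparr>) (abelianization H (h ` U))"
    using epi_compose[OF epi_restrict_subgroup[OF assms]
        H.abelianization_projection_epi[OF subgroup_img_is_subgroup[OF assms]]] .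
  then have "?q \<circ> restrict h U \<in> hom (G\<lparr>carrier := U\<rparr>) (abelianization H (h ` U))"
    by (simp add: epi_def)
  then have "(\<lambda>x. ?q (h x)) \<in> hom (G\<lparr>carrier := U\<rparr>) (abelianization H (h ` U))"
    by (rule U.hom_restrict) simp
  moreover have "(?q \<circ> restrict h U) ` U = (\<lambda>x. ?q (h x)) ` U"
    by (rule image_cong) simp_all
  ultimately show ?thesis
    using q by (simp add: epi_def)
qed

text \<open>The kernel of that composite: \<open>h(x)\<close> has to lie in \<open>h(U)'\<close>, which is \<open>h(U')\<close>.\<close>

lemma image_coset_trivial_iff:
  assumes U: "subgroup U G" and x: "x \<in> U"
  shows "h x <#\<^bsub>H\<^esub> derived H (h ` U) = derived H (h ` U)
    \<longleftrightarrow> x \<in> derived G U <#> kernel G H h"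
proof -
  have sub: "U \<subseteq> carrier G" using subgroup.subset[OF U] .
  then have hU: "h ` U \<subseteq> carrier H" by auto
  have "h x <#\<^bsub>H\<^esub> derived H (h ` U) = derived H (h ` U) \<longleftrightarrow> h x \<in> derived H (h ` U)"
    using H.l_coset_eq_self_iff[OF H.derived_is_subgroup[OF hU]] hU x by auto
  also have "\<dots> \<longleftrightarrow> x \<in> derived G U <#> kernel G H h"
    unfolding derived_img[OF sub]
    using preimage_of_image_eq_set_mult_kernel[OF G.derived_in_carrier[OF sub]] sub x by auto
  finally show ?thesis .
qed

lemma ex1_induced_abelianization_epi:
  assumes U: "subgroup U G"
  shows "\<exists>!f. f \<in> extensional (carrier (abelianization G U)) \<and>
    f \<in> epi (abelianization G U) (abelianization H (h ` U)) \<and>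
    (\<forall>x\<in>U. f (x <# derived G U) = h x <#\<^bsub>H\<^esub> derived H (h ` U))"
proof (rule ex_ex1I)
  let ?A = "abelianization G U" and ?B = "abelianization H (h ` U)"
  let ?p = "\<lambda>x. h x <#\<^bsub>H\<^esub> derived H (h ` U)"
  have p: "?p \<in> epi (G\<lparr>carrier := U\<rparr>) ?B"
    using epi_onto_abelianization_of_image[OF U] .
  interpret A: group ?A using G.group_abelianization[OF U] .
  interpret p: group_hom "G\<lparr>carrier := U\<rparr>" ?B ?p
    using G.subgroup_imp_group[OF U] p
      H.group_abelianization[OF subgroup_img_is_subgroup[OF U]]
    by (simp add: group_hom_def group_hom_axioms_def epi_def)
  (* The composite p kills U' since U' is contained in U' ker h. *)
  have "derived G U \<subseteq> kernel (G\<lparr>carrier := U\<rparr>) ?B ?p"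
  proof
    fix d assume d: "d \<in> derived G U"
    then have dU: "d \<in> U" using G.derived_subset_subgroup[OF U] by auto
    then have "d \<in> carrier G" using subgroup.subset[OF U] by auto
    then have "d \<in> derived G U <#> kernel G H h"
      using d preimage_of_image_eq_set_mult_kernel
        G.derived_in_carrier[OF subgroup.subset[OF U]] by blast
    then show "d \<in> kernel (G\<lparr>carrier := U\<rparr>) ?B ?p"
      using dU image_coset_trivial_iff[OF U dU] by (simp add: kernel_def H.one_abelianization)
  qed
  then obtain g where g: "g \<in> hom (G\<lparr>carrier := U\<rparr> Mod derived G U) ?B"
    and gr: "\<And>x. x \<in> carrier (G\<lparr>carrier := U\<rparr>) \<Longrightarrow>
      g (derived G U #>\<^bsub>G\<lparr>carrier := U\<rparr>\<^esub> x) = ?p x"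
    using p.FactGroup_universal_kernel[OF G.derived_subgroup_is_normal[OF U]] by blast
  have gp: "g (x <# derived G U) = ?p x" if "x \<in> U" for x
    using gr[of x] that by (simp add: G.abelianization_projection_eq[OF U that])
  have "restrict g (carrier ?A) \<in> hom ?A ?B"
    by (rule A.hom_restrict[OF g[folded abelianization_def]]) simp
  moreover have "g ` carrier ?A = carrier ?B"
    using p gp by (simp add: G.carrier_abelianization[OF U] epi_def image_image)
  ultimately have "restrict g (carrier ?A) \<in> epi ?A ?B"
    by (simp add: epi_def)
  then show "\<exists>f. f \<in> extensional (carrier ?A) \<and> f \<in> epi ?A ?B \<and>
      (\<forall>x\<in>U. f (x <# derived G U) = ?p x)"
    using gp by (intro exI[of _ "restrict g (carrier ?A)"])
      (simp add: G.carrier_abelianization[OF U])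
next
  fix f g
  assume "f \<in> extensional (carrier (abelianization G U)) \<and>
      f \<in> epi (abelianization G U) (abelianization H (h ` U)) \<and>
      (\<forall>x\<in>U. f (x <# derived G U) = h x <#\<^bsub>H\<^esub> derived H (h ` U))"
    and "g \<in> extensional (carrier (abelianization G U)) \<and>
      g \<in> epi (abelianization G U) (abelianization H (h ` U)) \<and>
      (\<forall>x\<in>U. g (x <# derived G U) = h x <#\<^bsub>H\<^esub> derived H (h ` U))"
  then show "f = g"
    by (intro extensionalityI[of f "carrier (abelianization G U)" g])
      (auto simp: G.carrier_abelianization[OF U])
qed

lemma kernel_induced_abelianization:
  assumes U: "subgroup U G"
    and f: "\<And>x. x \<in> U \<Longrightarrow> f (x <# derived G U) = h x <#\<^bsub>H\<^esub> derived H (h ` U)"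
  shows "kernel (abelianization G U) (abelianization H (h ` U)) f =
    (\<lambda>x. x <# derived G U) ` ((derived G U <#> kernel G H h) \<inter> U)"
proof -
  have "f (x <# derived G U) = \<one>\<^bsub>abelianization H (h ` U)\<^esub>
      \<longleftrightarrow> x \<in> derived G U <#> kernel G H h" if "x \<in> U" for x
    using image_coset_trivial_iff[OF U that] f[OF that] by (simp add: H.one_abelianization)
  then show ?thesis
    unfolding kernel_def[of "abelianization G U"] G.carrier_abelianization[OF U] by blast
qed

lemma induced_abelianization_iso_iff:
  assumes U: "subgroup U G"
    and epi: "f \<in> epi (abelianization G U) (abelianization H (h ` U))"
    and f: "\<And>x. x \<in> U \<Longrightarrow> f (x <# derived G U) = h x <#\<^bsub>H\<^esub> derived H (h ` U)"
  shows "f \<in> iso (abelianization G U) (abelianization H (h ` U))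
    \<longleftrightarrow> kernel G H h \<inter> U \<subseteq> derived G U"
proof -
  let ?A = "abelianization G U" and ?B = "abelianization H (h ` U)"
  let ?D = "derived G U" and ?W = "(derived G U <#> kernel G H h) \<inter> U"
  have sub: "U \<subseteq> carrier G" using subgroup.subset[OF U] .
  have D: "subgroup ?D G" using G.derived_is_subgroup[OF sub] .
  interpret A: group ?A using G.group_abelianization[OF U] .
  interpret f: group_hom ?A ?B f
    using epi H.group_abelianization[OF subgroup_img_is_subgroup[OF U]] A.group_axioms
    by (simp add: group_hom_def group_hom_axioms_def epi_def)
  have "f \<in> iso ?A ?B \<longleftrightarrow> kernel ?A ?B f = {\<one>\<^bsub>?A\<^esub>}"
    using epi iso_kernel_image[OF A.group_axioms f.H.group_axioms] by (auto simp: epi_def)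
  also have "\<dots> \<longleftrightarrow> kernel ?A ?B f \<subseteq> {\<one>\<^bsub>?A\<^esub>}"
    using subgroup.one_closed[OF f.subgroup_kernel] by blast
  also have "\<dots> \<longleftrightarrow> (\<forall>x\<in>?W. x <# ?D = ?D)"
    by (auto simp: kernel_induced_abelianization[OF U f] G.one_abelianization)
  also have "\<dots> \<longleftrightarrow> ?W \<subseteq> ?D"
    using G.l_coset_eq_self_iff[OF D] sub by blast
  also have "\<dots> \<longleftrightarrow> kernel G H h \<inter> U \<subseteq> ?D"
    by (rule set_mult_kernel_Int_subset_iff[OF D U G.derived_subset_subgroup[OF U]])
  finally show ?thesis .
qed

end

section \<open>Abelianization of a homomorphic image\<close>

theorem theorem5p1:
  fixes G :: "('a, 'm) monoid_scheme" and T :: "('b, 'n) monoid_scheme"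
    and \<phi> :: "'a \<Rightarrow> 'b" and U :: "'a set" and H V :: "'b set"
  assumes "group G" and "group T"
    and "\<phi> \<in> hom G T"
    and "H = \<phi> ` carrier G"
    and "subgroup U G"
    and "V = \<phi> ` U"
  shows
    \<comment> \<open>the images are subgroups: \<open>V \<le> H \<le> T\<close>\<close>
    "subgroup H T \<and> subgroup V (T\<lparr>carrier := H\<rparr>) \<and>
    \<comment> \<open>(1)\<close>
     derived T V = \<phi> ` derived G U \<and>
    \<comment> \<open>(2): the restriction is epi and induces a unique epimorphism of the abelianizations\<close>
     restrict \<phi> U \<in> epi (G\<lparr>carrier := U\<rparr>) (T\<lparr>carrier := V\<rparr>) \<and>
     (\<exists>!f. f \<in> extensional (carrier (abelianization G U)) \<and>
           f \<in> epi (abelianization G U) (abelianization T V) \<and>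
           (\<forall>x\<in>U. f (x <#\<^bsub>G\<^esub> derived G U) = \<phi> x <#\<^bsub>T\<^esub> derived T V)) \<and>
     (\<forall>f. f \<in> epi (abelianization G U) (abelianization T V) \<and>
          (\<forall>x\<in>U. f (x <#\<^bsub>G\<^esub> derived G U) = \<phi> x <#\<^bsub>T\<^esub> derived T V) \<longrightarrow>
        abelianization T V \<cong>
          abelianization G U Mod kernel (abelianization G U) (abelianization T V) f \<and>
        kernel (abelianization G U) (abelianization T V) f =
          carrier ((G\<lparr>carrier := (derived G U <#>\<^bsub>G\<^esub> kernel G T \<phi>) \<inter> U\<rparr>) Mod derived G U) \<and>
    \<comment> \<open>(3), where the kernel is that of the restriction to \<open>U\<close>: for \<open>U = 1\<close> the induced map is always
       an isomorphism, so \<open>ker \<phi> \<le> U'\<close> is not necessary unless \<open>ker \<phi> \<le> U\<close>. The two implications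
       below give the version with \<open>ker \<phi>\<close>: sufficiency always, equivalence if \<open>ker \<phi> \<le> U\<close>.\<close>
        (f \<in> iso (abelianization G U) (abelianization T V) \<and>
            abelianization T V \<cong> abelianization G U
          \<longleftrightarrow> kernel (G\<lparr>carrier := U\<rparr>) (T\<lparr>carrier := V\<rparr>) (restrict \<phi> U) \<subseteq> derived G U) \<and>
        (kernel G T \<phi> \<subseteq> derived G U \<longrightarrow>
            f \<in> iso (abelianization G U) (abelianization T V) \<and>
            abelianization T V \<cong> abelianization G U) \<and>
        (kernel G T \<phi> \<subseteq> U \<longrightarrow>
           (f \<in> iso (abelianization G U) (abelianization T V) \<and>
            abelianization T V \<cong> abelianization G U
          \<longleftrightarrow> kernel G T \<phi> \<subseteq> derived G U)))"
proof -
  interpret group_hom G T \<phi>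
    using assms by (simp add: group_hom_def group_hom_axioms_def)
  note U = \<open>subgroup U G\<close>
  let ?A = "abelianization G U" and ?B = "abelianization T V" and ?D = "derived G U"
  have sub: "U \<subseteq> carrier G" using subgroup.subset[OF U] .
  have Vdef: "\<phi> ` U = V" using assms(6) by simp
  have H: "subgroup H T"
    using subgroup_img_is_subgroup[OF G.subgroup_self] assms(4) by simp
  have V: "subgroup V T"
    using subgroup_img_is_subgroup[OF U] Vdef by simp
  have VH: "subgroup V (T\<lparr>carrier := H\<rparr>)"
    using H.subgroup_incl[OF V H] sub assms(4,6) by blast
  have der: "derived T V = \<phi> ` ?D"
    using derived_img[OF sub] Vdef by simp
  have iso_sym: "f \<in> iso ?A ?B \<Longrightarrow> ?B \<cong> ?A" for f
    using G.group_abelianization[OF U] group.iso_sym is_isoI by blast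
  have quot: "?B \<cong> ?A Mod kernel ?A ?B f" if f: "f \<in> epi ?A ?B" for f
  proof -
    interpret f: group_hom ?A ?B f
      using f G.group_abelianization[OF U] H.group_abelianization[OF V]
      by (simp add: group_hom_def group_hom_axioms_def epi_def)
    have "?A Mod kernel ?A ?B f \<cong> ?B"
      using f f.FactGroup_iso by (simp add: epi_def)
    then show ?thesis
      using group.iso_sym[OF normal.factorgroup_is_group[OF f.normal_kernel]] by blast
  qed
  have ker: "kernel ?A ?B f = carrier ((G\<lparr>carrier := (?D <#>\<^bsub>G\<^esub> kernel G T \<phi>) \<inter> U\<rparr>) Mod ?D)"
    if "\<forall>x\<in>U. f (x <#\<^bsub>G\<^esub> ?D) = \<phi> x <#\<^bsub>T\<^esub> derived T V" for f
    using kernel_induced_abelianization[OF U, of f] that G.l_coset_derived_eq_r_coset[OF U]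
    by (simp add: Vdef carrier_FactGroup r_coset_def)
  have iso_iff: "f \<in> iso ?A ?B \<longleftrightarrow> kernel G T \<phi> \<inter> U \<subseteq> ?D"
    if "f \<in> epi ?A ?B" "\<forall>x\<in>U. f (x <#\<^bsub>G\<^esub> ?D) = \<phi> x <#\<^bsub>T\<^esub> derived T V" for f
    using induced_abelianization_iso_iff[OF U, of f] that by (simp add: Vdef)
  have kerU: "kernel (G\<lparr>carrier := U\<rparr>) (T\<lparr>carrier := V\<rparr>) (restrict \<phi> U) = kernel G T \<phi> \<inter> U"
    using kernel_restrict_subgroup[OF U] by (simp add: Vdef)
  have three: "(f \<in> iso ?A ?B \<and> ?B \<cong> ?A
          \<longleftrightarrow> kernel (G\<lparr>carrier := U\<rparr>) (T\<lparr>carrier := V\<rparr>) (restrict \<phi> U) \<subseteq> ?D) \<and>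
        (kernel G T \<phi> \<subseteq> ?D \<longrightarrow> f \<in> iso ?A ?B \<and> ?B \<cong> ?A) \<and>
        (kernel G T \<phi> \<subseteq> U \<longrightarrow> (f \<in> iso ?A ?B \<and> ?B \<cong> ?A \<longleftrightarrow> kernel G T \<phi> \<subseteq> ?D))"
    if "f \<in> epi ?A ?B" "\<forall>x\<in>U. f (x <#\<^bsub>G\<^esub> ?D) = \<phi> x <#\<^bsub>T\<^esub> derived T V" for f
    unfolding kerU using iso_iff[OF that] iso_sym[of f] by (auto simp: Int_absorb2)
  have epi: "restrict \<phi> U \<in> epi (G\<lparr>carrier := U\<rparr>) (T\<lparr>carrier := V\<rparr>)"
    using epi_restrict_subgroup[OF U] by (simp add: Vdef)
  show ?thesis
    by (intro conjI allI H VH der epi ex1_induced_abelianization_epi[OF U, unfolded Vdef])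
      (use quot ker three in blast)
qed

end
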